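(* Let $G$ be an $r$-regular graph with $n$ vertices and $m$ edges, where $r\ge 2$, and let $\alpha\in[0,1)$. Then $$P_{A_\alpha(l(G))}(\lambda)=(\lambda-2r\alpha+2)^{m-n}P_{A_\alpha(G)}(\lambda-r+2)$$ and $$P_{A_\alpha(l(G))}(\lambda)=(\lambda-2r\alpha+2)^{m-n}(1-\alpha)^nP_{A(G)}\!\left(\frac{\lambda-r(\alpha+1)+2}{1-\alpha}\right).$$
   Context: For a simple graph $G$ with adjacency matrix $A(G)$ and diagonal degree matrix $D(G)$, $A_\alpha(G)=\alpha D(G)+(1-\alpha)A(G)$. For a square matrix $M$ of order $k$, $P_M(\lambda)=\det(\lambda I_k-M)$. The line graph $l(G)$ has the edges of $G$ as vertices, two being adjacent iff the corresponding edges of $G$ share an endpoint. *)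

theory Defs
  imports Complex_Main "Jordan_Normal_Form.Char_Poly"
begin

record 'a ugraph =
  verts :: "'a set"
  edges :: "'a set set"

definition simple_graph :: "'a ugraph \<Rightarrow> bool" where
  "simple_graph G \<longleftrightarrow>
     finite (verts G) \<and> (\<forall>e \<in> edges G. e \<subseteq> verts G \<and> card e = 2)"

definition degree_at :: "'a ugraph \<Rightarrow> 'a \<Rightarrow> nat" where
  "degree_at G v = card {e \<in> edges G. v \<in> e}"

definition regular :: "nat \<Rightarrow> 'a ugraph \<Rightarrow> bool" where
  "regular r G \<longleftrightarrow> (\<forall>v \<in> verts G. degree_at G v = r)"

definition line_graph :: "'a ugraph \<Rightarrow> 'a set ugraph" where
  "line_graph G =
     \<lparr> verts = edges G,
       edges = {{e, f} | e f. e \<in> edges G \<and> f \<in> edges G \<and> e \<noteq> f \<and> e \<inter> f \<noteq> {}} \<rparr>"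

text \<open>
  The matrices of a graph are indexed by positions in a list \<open>vs\<close> enumerating the vertices.
\<close>

definition vertex_enum :: "'a ugraph \<Rightarrow> 'a list \<Rightarrow> bool" where
  "vertex_enum G vs \<longleftrightarrow> distinct vs \<and> set vs = verts G"

text \<open>
  For \<open>i = j\<close> the set \<open>{vs ! i, vs ! j}\<close> is a singleton, hence not an edge of a
  simple graph, so the diagonal of the adjacency matrix is zero.
\<close>

definition adj_matrix :: "'a ugraph \<Rightarrow> 'a list \<Rightarrow> real mat" where
  "adj_matrix G vs =
     mat (length vs) (length vs) (\<lambda>(i, j). if {vs ! i, vs ! j} \<in> edges G then 1 else 0)"

definition deg_matrix :: "'a ugraph \<Rightarrow> 'a list \<Rightarrow> real mat" where
  "deg_matrix G vs =
     mat (length vs) (length vs) (\<lambda>(i, j). if i = j then real (degree_at G (vs ! i)) else 0)"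

definition A_alpha :: "real \<Rightarrow> 'a ugraph \<Rightarrow> 'a list \<Rightarrow> real mat" where
  "A_alpha \<alpha> G vs = \<alpha> \<cdot>\<^sub>m deg_matrix G vs + (1 - \<alpha>) \<cdot>\<^sub>m adj_matrix G vs"

lemma simple_graph_line_graph:
  assumes "simple_graph G"
  shows "simple_graph (line_graph G)"
proof -
  have "edges G \<subseteq> Pow (verts G)" and "finite (verts G)"
    using assms by (auto simp: simple_graph_def)
  then have "finite (edges G)"
    by (meson finite_Pow_iff finite_subset)
  then show ?thesis
    by (auto simp: simple_graph_def line_graph_def card_2_iff)
qed

lemma poly_char_poly_eq_det:
  fixes M :: "real mat"
  assumes M: "M \<in> carrier_mat k k"
  shows "poly (char_poly M) x = det (x \<cdot>\<^sub>m 1\<^sub>m k - M)"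
  unfolding char_poly_def
  by (rule poly_det_cong[of _ k]) (use M in \<open>auto simp: char_poly_matrix_def\<close>)

end

theory Submission imports Defs begin

text \<open>
  If \<open>N\<close> is the vertex-edge incidence matrix, then \<open>N N\<^sup>T = r I + A(G)\<close> and
  \<open>N\<^sup>T N = 2 I + A(l(G))\<close>, so \<open>A\<^sub>\<alpha>(G)\<close> and \<open>A\<^sub>\<alpha>(l(G))\<close> are scalar shifts of
  \<open>(1 - \<alpha>) N N\<^sup>T\<close> and \<open>(1 - \<alpha>) N\<^sup>T N\<close>, and the characteristic polynomials of these two
  products differ by the factor \<open>\<lambda>\<^bsup>m - n\<^esup>\<close>.
\<close>

section \<open>Characteristic polynomials\<close>

text \<open>Sylvester's determinant identity: both sides come from one block matrix through its two
  Schur complements. Keeping powers of \<open>t\<close> on both sides avoids dividing by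
  \<open>t\<close>, so the identity holds over polynomial rings too.\<close>

lemma det_smult_one_minus_mult_commute:
  fixes X Y :: "'a :: idom mat"
  assumes X: "X \<in> carrier_mat m n" and Y: "Y \<in> carrier_mat n m"
  shows "t ^ n * det (t \<cdot>\<^sub>m 1\<^sub>m m - X * Y) = t ^ m * det (t \<cdot>\<^sub>m 1\<^sub>m n - Y * X)"
proof -
  \<comment> \<open>Block elimination with \<open>?K\<close> and \<open>?L\<close> clears the lower left and upper right block of \<open>?M\<close>.\<close>
  let ?M = "four_block_mat (t \<cdot>\<^sub>m 1\<^sub>m m) X Y (1\<^sub>m n)"
  let ?K = "four_block_mat (1\<^sub>m m) (0\<^sub>m m n) (- Y) (1\<^sub>m n)"
  let ?L = "four_block_mat (1\<^sub>m m) (- X) (0\<^sub>m n m) (t \<cdot>\<^sub>m 1\<^sub>m n)"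
  have carrier: "?M \<in> carrier_mat (m + n) (m + n)" "?K \<in> carrier_mat (m + n) (m + n)"
      "?L \<in> carrier_mat (m + n) (m + n)"
    by (auto intro!: four_block_carrier_mat)
  have "?M * ?K = four_block_mat (t \<cdot>\<^sub>m 1\<^sub>m m * 1\<^sub>m m + X * (- Y)) (t \<cdot>\<^sub>m 1\<^sub>m m * 0\<^sub>m m n + X * 1\<^sub>m n)
      (Y * 1\<^sub>m m + 1\<^sub>m n * (- Y)) (Y * 0\<^sub>m m n + 1\<^sub>m n * 1\<^sub>m n)"
    by (rule mult_four_block_mat) (use X Y in auto)
  also have "\<dots> = four_block_mat (t \<cdot>\<^sub>m 1\<^sub>m m - X * Y) X (0\<^sub>m n m) (1\<^sub>m n)"
    by (rule cong_four_block_mat) (use X Y in \<open>auto\<close>)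
  finally have MtK: "?M * ?K = four_block_mat (t \<cdot>\<^sub>m 1\<^sub>m m - X * Y) X (0\<^sub>m n m) (1\<^sub>m n)" .
  have "?M * ?L = four_block_mat (t \<cdot>\<^sub>m 1\<^sub>m m * 1\<^sub>m m + X * 0\<^sub>m n m) (t \<cdot>\<^sub>m 1\<^sub>m m * (- X) + X * (t \<cdot>\<^sub>m 1\<^sub>m n))
      (Y * 1\<^sub>m m + 1\<^sub>m n * 0\<^sub>m n m) (Y * (- X) + 1\<^sub>m n * (t \<cdot>\<^sub>m 1\<^sub>m n))"
    by (rule mult_four_block_mat) (use X Y in auto)
  also have "\<dots> = four_block_mat (t \<cdot>\<^sub>m 1\<^sub>m m) (0\<^sub>m m n) Y (t \<cdot>\<^sub>m 1\<^sub>m n - Y * X)"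
    by (rule cong_four_block_mat) (use X Y in \<open>auto\<close>)
  finally have MtL: "?M * ?L = four_block_mat (t \<cdot>\<^sub>m 1\<^sub>m m) (0\<^sub>m m n) Y (t \<cdot>\<^sub>m 1\<^sub>m n - Y * X)" .
  have "det ?K = 1"
    by (subst det_four_block_mat_upper_right_zero[of _ m _ n]) (use Y in auto)
  then have "det ?M = det (?M * ?K)"
    using det_mult[OF carrier(1,2)] by simp
  also have "\<dots> = det (t \<cdot>\<^sub>m 1\<^sub>m m - X * Y)"
    unfolding MtK by (subst det_four_block_mat_lower_left_zero[of _ m _ n]) (use X Y in auto)
  finally have M: "det ?M = det (t \<cdot>\<^sub>m 1\<^sub>m m - X * Y)" .
  have "det ?L = t ^ n"
    by (subst det_four_block_mat_lower_left_zero[of _ m _ n]) (use X in auto)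
  then have "t ^ n * det ?M = det (?M * ?L)"
    using det_mult[OF carrier(1,3)] by simp
  also have "\<dots> = t ^ m * det (t \<cdot>\<^sub>m 1\<^sub>m n - Y * X)"
    unfolding MtL by (subst det_four_block_mat_upper_right_zero[of _ m _ n]) (use X Y in auto)
  finally show ?thesis
    unfolding M .
qed

lemma char_poly_mult_commute:
  fixes X Y :: "'a :: idom mat"
  assumes X: "X \<in> carrier_mat m n" and Y: "Y \<in> carrier_mat n m" and "n \<le> m"
  shows "char_poly (X * Y) = [:0, 1:] ^ (m - n) * char_poly (Y * X)"
proof -
  \<comment> \<open>Entries become constant polynomials, so a characteristic polynomial is a
    determinant \<open>det (t I - M)\<close> with \<open>t = [:0, 1:]\<close>.\<close>
  let ?l = "map_mat (\<lambda>a :: 'a. [:a:])"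
  interpret l: comm_ring_hom "\<lambda>a :: 'a. [:a:]"
    by unfold_locales auto
  have l: "?l X \<in> carrier_mat m n" "?l Y \<in> carrier_mat n m"
    using X Y by auto
  have char: "char_poly A = det ([:0, 1:] \<cdot>\<^sub>m 1\<^sub>m k - ?l A)" if "A \<in> carrier_mat k k" for A k
    unfolding char_poly_defs by (rule arg_cong[of _ _ det], rule eq_matI) (use that in auto)
  \<comment> \<open>Taking the variable itself for \<open>t\<close> makes \<open>t ^ n\<close> cancellable, so that the identity
    also holds at the root \<open>0\<close>.\<close>
  have "[:0, 1:] ^ n * char_poly (X * Y) = [:0, 1:] ^ m * char_poly (Y * X)"
    using det_smult_one_minus_mult_commute[OF l, of "[:0, 1:]"] X Y
    by (simp add: char[of _ m] char[of _ n] l.mat_hom_mult[OF X Y] l.mat_hom_mult[OF Y X])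
  also have "\<dots> = [:0, 1:] ^ n * ([:0, 1:] ^ (m - n) * char_poly (Y * X))"
    using \<open>n \<le> m\<close> by (simp add: power_add[symmetric] mult.assoc[symmetric])
  finally show ?thesis
    by simp
qed

text \<open>Each of the \<open>k\<close> rows of the determinant yields one factor \<open>b\<close>.
  The case \<open>b = 1\<close> handles scalar shifts, and \<open>b = 1 - \<alpha>\<close> passes
  from \<open>A_alpha\<close> to the adjacency matrix.\<close>

lemma poly_char_poly_affine:
  fixes A :: "real mat"
  assumes A: "A \<in> carrier_mat k k" and "b \<noteq> 0"
  shows "poly (char_poly (c \<cdot>\<^sub>m 1\<^sub>m k + b \<cdot>\<^sub>m A)) x = b ^ k * poly (char_poly A) ((x - c) / b)"
proof -
  have "poly (char_poly (c \<cdot>\<^sub>m 1\<^sub>m k + b \<cdot>\<^sub>m A)) x = det (x \<cdot>\<^sub>m 1\<^sub>m k - (c \<cdot>\<^sub>m 1\<^sub>m k + b \<cdot>\<^sub>m A))"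
    by (rule poly_char_poly_eq_det) (use A in auto)
  also have "x \<cdot>\<^sub>m 1\<^sub>m k - (c \<cdot>\<^sub>m 1\<^sub>m k + b \<cdot>\<^sub>m A) = b \<cdot>\<^sub>m (((x - c) / b) \<cdot>\<^sub>m 1\<^sub>m k - A)"
    by (rule eq_matI) (use A \<open>b \<noteq> 0\<close> in \<open>auto simp: field_simps\<close>)
  also have "det \<dots> = b ^ k * poly (char_poly A) ((x - c) / b)"
    using A by (simp add: poly_char_poly_eq_det[OF A])
  finally show ?thesis .
qed

section \<open>Incidence matrices\<close>

text \<open>The unsigned incidence matrix: without orientation signs, adjacency enters both Gram
  products with a plus sign.\<close>

definition incidence_matrix :: "'a list \<Rightarrow> 'a set list \<Rightarrow> real mat" where
  "incidence_matrix vs es =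
     mat (length vs) (length es) (\<lambda>(i, j). if vs ! i \<in> es ! j then 1 else 0)"

lemma incidence_matrix_carrier [simp]:
  "incidence_matrix vs es \<in> carrier_mat (length vs) (length es)"
  "dim_row (incidence_matrix vs es) = length vs"
  "dim_col (incidence_matrix vs es) = length es"
  by (simp_all add: incidence_matrix_def)

lemma sum_nth_indicator:
  assumes "distinct xs"
  shows "(\<Sum>i = 0..<length xs. if P (xs ! i) then 1 else 0) = real (card {y \<in> set xs. P y})"
proof -
  have "(\<Sum>i = 0..<length xs. if P (xs ! i) then 1 else 0 :: real) = (\<Sum>y\<in>set xs. if P y then 1 else 0)"
    by (rule sum.reindex_bij_betw) (simp add: bij_betw_nth assms atLeast0LessThan)
  then show ?thesis
    by (simp add: sum.If_cases Int_def)
qed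

lemma incidence_mult_transpose_index:
  assumes "distinct es" "i < length vs" "j < length vs"
  shows "(incidence_matrix vs es * transpose_mat (incidence_matrix vs es)) $$ (i, j) =
    real (card {e \<in> set es. vs ! i \<in> e \<and> vs ! j \<in> e})"
proof -
  have "(incidence_matrix vs es * transpose_mat (incidence_matrix vs es)) $$ (i, j) =
      (\<Sum>k = 0..<length es. if vs ! i \<in> es ! k \<and> vs ! j \<in> es ! k then 1 else 0)"
    using assms by (auto simp: incidence_matrix_def scalar_prod_def intro!: sum.cong)
  then show ?thesis
    using sum_nth_indicator[OF assms(1), of "\<lambda>e. vs ! i \<in> e \<and> vs ! j \<in> e"] by simp
qed

lemma transpose_incidence_mult_index:
  assumes "distinct vs" "i < length es" "j < length es"
  shows "(transpose_mat (incidence_matrix vs es) * incidence_matrix vs es) $$ (i, j) =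
    real (card {v \<in> set vs. v \<in> es ! i \<and> v \<in> es ! j})"
proof -
  have "(transpose_mat (incidence_matrix vs es) * incidence_matrix vs es) $$ (i, j) =
      (\<Sum>k = 0..<length vs. if vs ! k \<in> es ! i \<and> vs ! k \<in> es ! j then 1 else 0)"
    using assms by (auto simp: incidence_matrix_def scalar_prod_def intro!: sum.cong)
  then show ?thesis
    using sum_nth_indicator[OF assms(1), of "\<lambda>v. v \<in> es ! i \<and> v \<in> es ! j"] by simp
qed

section \<open>Regular graphs and their line graphs\<close>

lemma simple_graph_finite_edges:
  assumes "simple_graph G"
  shows "finite (edges G)"
  using assms finite_subset[of "edges G" "Pow (verts G)"] by (auto simp: simple_graph_def)

lemma simple_graph_edge:
  assumes "simple_graph G" "e \<in> edges G"
  shows "e \<subseteq> verts G" "card e = 2" "finite e"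
  using assms finite_subset[of e "verts G"] by (auto simp: simple_graph_def)

lemma simple_graph_edge_eq:
  assumes "simple_graph G" "e \<in> edges G" "u \<in> e" "v \<in> e" "u \<noteq> v"
  shows "e = {u, v}"
  using simple_graph_edge(2)[OF assms(1,2)] assms(3-) by (auto simp: card_2_iff)

text \<open>An edge is determined by any two of its vertices, so two common vertices would force
  \<open>e = f\<close>.\<close>

lemma card_inter_edges:
  assumes "simple_graph G" "e \<in> edges G" "f \<in> edges G" "e \<noteq> f"
  shows "card (e \<inter> f) = (if e \<inter> f = {} then 0 else 1)"
proof -
  have "u = v" if "u \<in> e \<inter> f" "v \<in> e \<inter> f" for u v
    using simple_graph_edge_eq[OF assms(1,2), of u v] simple_graph_edge_eq[OF assms(1,3), of u v]
      that assms(4) by blast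
  then have "e \<inter> f = {u}" if "u \<in> e \<inter> f" for u
    using that by blast
  then show ?thesis
    by (metis card.empty card_1_singleton_iff One_nat_def ex_in_conv)
qed

lemma line_graph_edge_iff:
  "{e, f} \<in> edges (line_graph G) \<longleftrightarrow>
     e \<in> edges G \<and> f \<in> edges G \<and> e \<noteq> f \<and> e \<inter> f \<noteq> {}"
  by (auto simp: line_graph_def doubleton_eq_iff)

text \<open>Double counting of incident pairs. Taking \<open>S = verts G\<close> gives the handshake
  identity, and taking an edge for \<open>S\<close> gives its degree in the line graph.\<close>

lemma sum_card_inter_edges:
  assumes "simple_graph G" "finite S"
  shows "(\<Sum>e\<in>edges G. card (S \<inter> e)) = (\<Sum>v\<in>S. degree_at G v)"
proof -
  have "(\<Sum>e\<in>edges G. card (S \<inter> e)) = (\<Sum>e\<in>edges G. \<Sum>v\<in>S. if v \<in> e then 1 else 0)"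
    using assms(2) by (simp add: sum.If_cases)
  also have "\<dots> = (\<Sum>v\<in>S. \<Sum>e\<in>edges G. if v \<in> e then 1 else 0)"
    by (rule sum.swap)
  also have "\<dots> = (\<Sum>v\<in>S. degree_at G v)"
    using simple_graph_finite_edges[OF assms(1)]
    by (simp add: sum.If_cases degree_at_def Int_def)
  finally show ?thesis .
qed

lemma regular_handshake:
  assumes G: "simple_graph G" "regular r G"
  shows "2 * card (edges G) = r * card (verts G)"
proof -
  have "(\<Sum>e\<in>edges G. card (verts G \<inter> e)) = (\<Sum>e\<in>edges G. 2)"
    by (rule sum.cong) (use simple_graph_edge[OF G(1)] in \<open>auto simp: Int_absorb1\<close>)
  moreover have "(\<Sum>v\<in>verts G. degree_at G v) = (\<Sum>v\<in>verts G. r)"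
    by (rule sum.cong) (use G(2) in \<open>auto simp: regular_def\<close>)
  ultimately show ?thesis
    using sum_card_inter_edges[OF G(1), of "verts G"] G(1) by (simp add: simple_graph_def mult.commute)
qed

lemma degree_at_line_graph:
  assumes G: "simple_graph G" "regular r G" and e: "e \<in> edges G"
  shows "degree_at (line_graph G) e + 2 = 2 * r"
proof -
  let ?N = "{f \<in> edges G. f \<noteq> e \<and> e \<inter> f \<noteq> {}}"
  have fin: "finite (edges G)"
    using simple_graph_finite_edges[OF G(1)] .
  \<comment> \<open>Distinct edges share at most one vertex, so the degree of \<open>e\<close> is the sum of
    \<open>card (e \<inter> f)\<close> over \<open>f \<noteq> e\<close>; the term \<open>f = e\<close> accounts for the \<open>2\<close>.\<close>
  have "{d \<in> edges (line_graph G). e \<in> d} = (\<lambda>f. {e, f}) ` ?N"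
    using e by (auto simp: line_graph_def)
  then have "degree_at (line_graph G) e = card ?N"
    by (simp add: degree_at_def card_image inj_on_def doubleton_eq_iff)
  also have "\<dots> = (\<Sum>f\<in>edges G - {e}. if e \<inter> f = {} then 0 else 1)"
    using fin by (simp add: sum.If_cases) (rule arg_cong[of _ _ card], auto)
  also have "\<dots> = (\<Sum>f\<in>edges G - {e}. card (e \<inter> f))"
    by (intro sum.cong refl card_inter_edges[OF G(1) e, symmetric]) auto
  finally have "degree_at (line_graph G) e + 2 = (\<Sum>f\<in>edges G. card (e \<inter> f))"
    using sum.remove[OF fin e, of "\<lambda>f. card (e \<inter> f)"] simple_graph_edge[OF G(1) e] by simp
  also have "\<dots> = (\<Sum>v\<in>e. degree_at G v)"
    by (rule sum_card_inter_edges) (use simple_graph_edge[OF G(1) e] G in auto)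
  also have "\<dots> = (\<Sum>v\<in>e. r)"
    by (rule sum.cong) (use simple_graph_edge[OF G(1) e] G(2) in \<open>auto simp: regular_def\<close>)
  finally show ?thesis
    using simple_graph_edge[OF G(1) e] by simp
qed

text \<open>An entry counts the edges through two given vertices: \<open>r\<close> on the diagonal,
  and off it only the edge joining them, if present.\<close>

lemma regular_incidence_mult_transpose:
  assumes G: "simple_graph G" "regular r G"
    and vs: "vertex_enum G vs" and es: "vertex_enum (line_graph G) es"
  shows "incidence_matrix vs es * transpose_mat (incidence_matrix vs es) =
    real r \<cdot>\<^sub>m 1\<^sub>m (length vs) + adj_matrix G vs" (is "?L = ?R")
proof (rule eq_matI)
  fix i j
  assume "i < dim_row ?R" "j < dim_col ?R"
  then have ij: "i < length vs" "j < length vs"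
    by (auto simp: adj_matrix_def)
  have es': "set es = edges G" "distinct es"
    using es by (auto simp: vertex_enum_def line_graph_def)
  have L: "?L $$ (i, j) = real (card {e \<in> edges G. vs ! i \<in> e \<and> vs ! j \<in> e})"
    using incidence_mult_transpose_index[OF es'(2) ij] es'(1) by simp
  show "?L $$ (i, j) = ?R $$ (i, j)"
  proof (cases "i = j")
    case True
    have "vs ! i \<in> verts G"
      using nth_mem[OF ij(1)] vs by (simp add: vertex_enum_def)
    then have "card {e \<in> edges G. vs ! i \<in> e} = r"
      using G(2) by (simp add: regular_def degree_at_def)
    moreover have "{vs ! i} \<notin> edges G"
      using simple_graph_edge(2)[OF G(1), of "{vs ! i}"] by auto
    ultimately show ?thesis
      unfolding L using ij by (simp add: True adj_matrix_def)
  next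
    case False
    then have "vs ! i \<noteq> vs ! j"
      using ij vs by (simp add: vertex_enum_def nth_eq_iff_index_eq)
    then have "{e \<in> edges G. vs ! i \<in> e \<and> vs ! j \<in> e} =
        {e \<in> edges G. e = {vs ! i, vs ! j}}"
      using simple_graph_edge_eq[OF G(1)] by blast
    also have "\<dots> = (if {vs ! i, vs ! j} \<in> edges G then {{vs ! i, vs ! j}} else {})"
      by auto
    finally show ?thesis
      unfolding L using False ij by (simp add: adj_matrix_def)
  qed
qed (auto simp: adj_matrix_def)

text \<open>An entry counts the common endpoints of two edges: 2 on the diagonal, and at most 1 for
  distinct edges.\<close>

lemma transpose_incidence_mult:
  assumes G: "simple_graph G"
    and vs: "vertex_enum G vs" and es: "vertex_enum (line_graph G) es"
  shows "transpose_mat (incidence_matrix vs es) * incidence_matrix vs es =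
    2 \<cdot>\<^sub>m 1\<^sub>m (length es) + adj_matrix (line_graph G) es" (is "?L = ?R")
proof (rule eq_matI)
  fix i j
  assume "i < dim_row ?R" "j < dim_col ?R"
  then have ij: "i < length es" "j < length es"
    by (auto simp: adj_matrix_def)
  then have e: "es ! i \<in> edges G" "es ! j \<in> edges G"
    using es nth_mem[of i es] nth_mem[of j es] by (auto simp: vertex_enum_def line_graph_def)
  have "{v \<in> set vs. v \<in> es ! i \<and> v \<in> es ! j} = es ! i \<inter> es ! j"
    using vs simple_graph_edge(1)[OF G e(1)] by (auto simp: vertex_enum_def)
  then have L: "?L $$ (i, j) = real (card (es ! i \<inter> es ! j))"
    using transpose_incidence_mult_index[of vs, OF _ ij] vs by (simp add: vertex_enum_def)
  have "es ! i \<noteq> es ! j" if "i \<noteq> j"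
    using that ij es by (simp add: vertex_enum_def nth_eq_iff_index_eq)
  \<comment> \<open>Without \<open>insert_absorb2\<close> the diagonal pair keeps the shape
    \<open>{e, e}\<close>, to which \<open>line_graph_edge_iff\<close> applies and gives entry
    0.\<close>
  then show "?L $$ (i, j) = ?R $$ (i, j)"
    unfolding L using ij card_inter_edges[OF G e] simple_graph_edge(2)[OF G e(1)] e
    by (cases "i = j") (auto simp: adj_matrix_def line_graph_edge_iff simp del: insert_absorb2)
qed (auto simp: adj_matrix_def)

lemma A_alpha_regular:
  assumes "regular r G" "vertex_enum G vs"
  shows "A_alpha \<alpha> G vs = (\<alpha> * real r) \<cdot>\<^sub>m 1\<^sub>m (length vs) + (1 - \<alpha>) \<cdot>\<^sub>m adj_matrix G vs"
  by (rule eq_matI)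
    (use assms nth_mem[of _ vs] in
      \<open>auto simp: A_alpha_def deg_matrix_def adj_matrix_def regular_def vertex_enum_def\<close>)

theorem theorem5:
  fixes G :: "'a ugraph" and vs :: "'a list" and es :: "'a set list"
    and r n m :: nat and \<alpha> x :: real
  assumes "simple_graph G"
    and "regular r G"
    and "r \<ge> 2"
    and "n = card (verts G)"
    and "m = card (edges G)"
    and "0 \<le> \<alpha>" and "\<alpha> < 1"
    and "vertex_enum G vs"
    and "vertex_enum (line_graph G) es"
  shows "poly (char_poly (A_alpha \<alpha> (line_graph G) es)) x =
           (x - 2 * real r * \<alpha> + 2) powi (int m - int n) *
           poly (char_poly (A_alpha \<alpha> G vs)) (x - real r + 2)
       \<and> poly (char_poly (A_alpha \<alpha> (line_graph G) es)) x =
           (x - 2 * real r * \<alpha> + 2) powi (int m - int n) * (1 - \<alpha>) ^ n *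
           poly (char_poly (adj_matrix G vs)) ((x - real r * (\<alpha> + 1) + 2) / (1 - \<alpha>))"
proof -
  let ?N = "incidence_matrix vs es"
  \<comment> \<open>Absorbing \<open>1 - \<alpha>\<close> into one factor lets both products carry
    it, so the commutation lemma applies directly.\<close>
  let ?X = "(1 - \<alpha>) \<cdot>\<^sub>m transpose_mat ?N"
  let ?L = "adj_matrix (line_graph G) es" and ?A = "adj_matrix G vs"
  note G = assms(1,2) and vs = assms(8) and es = assms(9)
  have n: "length vs = n" and m: "length es = m"
    using vs es assms(4,5) by (auto simp: vertex_enum_def line_graph_def distinct_card[symmetric])
  have A: "?A \<in> carrier_mat n n" and L: "?L \<in> carrier_mat m m"
    using n m by (auto simp: adj_matrix_def)
  have N: "?N \<in> carrier_mat n m"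
    using n m incidence_matrix_carrier(1)[of vs es] by simp
  \<comment> \<open>Since \<open>r \<ge> 2\<close>, the handshake identity gives
    \<open>2 * n \<le> r * n = 2 * m\<close>.\<close>
  have "2 * n \<le> 2 * m"
    using regular_handshake[OF G] assms(3-5) by simp
  then have "n \<le> m"
    by simp
  have "verts (line_graph G) = edges G"
    by (simp add: line_graph_def)
  then have reg: "regular (2 * r - 2) (line_graph G)"
    using degree_at_line_graph[OF G] by (fastforce simp: regular_def)
  have XN: "?X * ?N = (1 - \<alpha>) \<cdot>\<^sub>m (2 \<cdot>\<^sub>m 1\<^sub>m m + ?L)"
    using transpose_incidence_mult[OF G(1) vs es] N m
    by (simp add: mult_smult_assoc_mat[of _ m n _ m])
  have NX: "?N * ?X = (1 - \<alpha>) \<cdot>\<^sub>m (real r \<cdot>\<^sub>m 1\<^sub>m n + ?A)"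
    using regular_incidence_mult_transpose[OF G vs es] N n
    by (simp add: mult_smult_distrib[of _ n m _ n])
  \<comment> \<open>The shift is \<open>\<alpha> * (2 * r - 2) - 2 * (1 - \<alpha>)\<close>. For
    \<open>G\<close> below it is \<open>\<alpha> * r - (1 - \<alpha>) * r\<close>. The factor 1
    matches the form of \<open>poly_char_poly_affine\<close>.\<close>
  have line: "A_alpha \<alpha> (line_graph G) es = (2 * real r * \<alpha> - 2) \<cdot>\<^sub>m 1\<^sub>m m + 1 \<cdot>\<^sub>m (?X * ?N)"
    unfolding XN A_alpha_regular[OF reg es] m
    by (rule eq_matI) (use L assms(3) in \<open>auto simp: algebra_simps\<close>)
  have graph: "A_alpha \<alpha> G vs = (real r * (2 * \<alpha> - 1)) \<cdot>\<^sub>m 1\<^sub>m n + 1 \<cdot>\<^sub>m (?N * ?X)"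
    unfolding NX A_alpha_regular[OF G(2) vs] n
    by (rule eq_matI) (use A in \<open>auto simp: algebra_simps\<close>)
  have carrier: "?X \<in> carrier_mat m n" "?X * ?N \<in> carrier_mat m m" "?N * ?X \<in> carrier_mat n n"
    unfolding XN NX using A L N by auto
  let ?t = "x - 2 * real r * \<alpha> + 2"
  have "poly (char_poly (A_alpha \<alpha> (line_graph G) es)) x = poly (char_poly (?X * ?N)) ?t"
    unfolding line using carrier by (subst poly_char_poly_affine) (auto simp: algebra_simps)
  also have "\<dots> = ?t ^ (m - n) * poly (char_poly (?N * ?X)) ?t"
    by (simp add: char_poly_mult_commute[OF carrier(1) N \<open>n \<le> m\<close>])
  \<comment> \<open>Undoing the shift for \<open>G\<close>:
    \<open>?t + r * (2 * \<alpha> - 1) = x - r + 2\<close>.\<close>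
  also have "poly (char_poly (?N * ?X)) ?t = poly (char_poly (A_alpha \<alpha> G vs)) (x - real r + 2)"
    unfolding graph using carrier by (subst poly_char_poly_affine) (auto simp: algebra_simps)
  \<comment> \<open>The exponent is nonnegative, so no inverse of \<open>?t\<close> arises, even
    where \<open>?t = 0\<close>.\<close>
  also have "?t ^ (m - n) = ?t powi (int m - int n)"
    using \<open>n \<le> m\<close> by (simp flip: of_nat_diff)
  finally have first: "poly (char_poly (A_alpha \<alpha> (line_graph G) es)) x =
      ?t powi (int m - int n) * poly (char_poly (A_alpha \<alpha> G vs)) (x - real r + 2)" .
  \<comment> \<open>The second formula rescales the first, with shift \<open>\<alpha> * r\<close>
    and factor \<open>1 - \<alpha>\<close>, nonzero because \<open>\<alpha> < 1\<close>.\<close>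
  have "poly (char_poly (A_alpha \<alpha> G vs)) (x - real r + 2) =
      (1 - \<alpha>) ^ n * poly (char_poly ?A) ((x - real r + 2 - \<alpha> * real r) / (1 - \<alpha>))"
    unfolding A_alpha_regular[OF G(2) vs] n
    by (rule poly_char_poly_affine) (use A assms(7) in auto)
  also have "x - real r + 2 - \<alpha> * real r = x - real r * (\<alpha> + 1) + 2"
    by (simp add: algebra_simps)
  finally show ?thesis
    using first by (simp add: mult.assoc)
qed

end
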